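(* Assume $\operatorname{cov}\mathcal{M}=\mathfrak{c}$. Then for every positive integer $n$ there exists a set $A\subset\mathbb{R}^n$ with $\dim_H A=n$ such that there is no uniformly continuous function from $A$ onto a non-degenerate closed interval of $\mathbb{R}$.
   Context: $\mathfrak{c}$ is the cardinality of the continuum, $\mathcal{M}$ is the collection of first category (meager) subsets of $\mathbb{R}$, and $\operatorname{cov}\mathcal{M}$ is the least cardinality of a family of first category subsets of $\mathbb{R}$ whose union is $\mathbb{R}$. $\dim_H$ denotes Hausdorff dimension. *)

theory Defs
  imports "HOL-Analysis.Analysis"
begin

definition nowhere_dense :: "'a::topological_space set \<Rightarrow> bool" where
  "nowhere_dense S \<longleftrightarrow> interior (closure S) = {}"

definition meager :: "'a::topological_space set \<Rightarrow> bool" where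
  "meager S \<longleftrightarrow> (\<exists>N. countable N \<and> (\<forall>T\<in>N. nowhere_dense T) \<and> S \<subseteq> \<Union>N)"

definition meager_cover :: "real set set \<Rightarrow> bool" where
  "meager_cover F \<longleftrightarrow> (\<forall>M\<in>F. meager M) \<and> \<Union>F = UNIV"

text \<open>cov(M) = c: the least cardinality of a meager cover of the reals equals the
  cardinality of the continuum. Since the covers range over a nonempty class
  (e.g. singletons), this says: some meager cover has cardinality c, and every
  meager cover has cardinality at least c.\<close>
definition covM_eq_continuum :: bool where
  "covM_eq_continuum \<longleftrightarrow>
     (\<exists>F. meager_cover F \<and> (card_of F, card_of (UNIV::real set)) \<in> ordIso) \<and>
     (\<forall>F. meager_cover F \<longrightarrow> (card_of (UNIV::real set), card_of F) \<in> ordLeq)"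

definition diam_pow :: "real \<Rightarrow> 'a::metric_space set \<Rightarrow> real" where
  "diam_pow s U = (if U = {} then 0 else if s = 0 then 1 else diameter U powr s)"

definition hausdorff_pre :: "real \<Rightarrow> real \<Rightarrow> 'a::metric_space set \<Rightarrow> ennreal" where
  "hausdorff_pre s \<delta> A =
     (INF U \<in> {U :: nat \<Rightarrow> 'a set. A \<subseteq> (\<Union>i. U i) \<and>
                  (\<forall>i. bounded (U i) \<and> diameter (U i) \<le> \<delta>)}.
        (\<Sum>i. ennreal (diam_pow s (U i))))"

definition hausdorff_measure :: "real \<Rightarrow> 'a::metric_space set \<Rightarrow> ennreal" where
  "hausdorff_measure s A = (SUP \<delta> \<in> {0<..}. hausdorff_pre s \<delta> A)"

definition hausdorff_dim :: "'a::metric_space set \<Rightarrow> ereal" where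
  "hausdorff_dim A = (INF s \<in> {s::real. 0 \<le> s \<and> hausdorff_measure s A = 0}. ereal s)"

end

theory Submission
  imports Defs "HOL-Probability.Distribution_Functions"
begin

text \<open>
  A uniformly continuous function on \<open>A\<close> is determined by the closure of its graph, which is again
  single-valued, so there are only continuum many functions to defeat, and all but countably many of
  the closed fibres of each are Lebesgue null. A transfinite recursion of length continuum builds
  \<open>A\<close> inside the unit cube: it meets every compact subset of the cube of positive measure, so that
  \<open>A\<close> is not Lebesgue null and has full Hausdorff dimension, and it omits one fibre of each function.
  The recursion never gets stuck because under \<open>cov(M) = c\<close> fewer than continuum many closed null
  sets cannot cover a compact set \<open>K\<close> of positive measure. Indeed, some injection of the
  space into the line is continuous off a null set, hence on a nonnull compact subset of \<open>K\<close>; the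
  distribution function of the image measure maps the image of that subset onto the unit interval
  (up to end points) and the images of closed null sets to nowhere dense sets.
\<close>

unbundle cardinal_syntax

subsection \<open>Encoding subsets of the naturals and points by reals\<close>

lemma summable_ternary: "summable (\<lambda>k. (1/3::real) ^ k * indicator A k)"
  by (rule summable_comparison_test'[OF summable_geometric[of "1/3::real"], of 0])
     (auto simp: indicator_def)

text \<open>At the first disagreement \<open>k\<close> the digit of \<open>A\<close> contributes
  \<open>(1/3) ^ k\<close>, while all later digits of \<open>B\<close> together contribute at most
  half of that.\<close>

lemma ternary_less:
  fixes A B :: "nat set"
  assumes agree: "\<And>j. j < k \<Longrightarrow> j \<in> A \<longleftrightarrow> j \<in> B" and "k \<in> A" "k \<notin> B"
  shows "(\<Sum>j. (1/3::real) ^ j * indicator B j) < (\<Sum>j. (1/3) ^ j * indicator A j)"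
proof -
  let ?a = "\<lambda>j. (1/3::real) ^ j * indicator A j" and ?b = "\<lambda>j. (1/3::real) ^ j * indicator B j"
  have split: "suminf f = (\<Sum>n. f (n + Suc k)) + (\<Sum>i<k. f i) + f k" if "summable f" for f :: "nat \<Rightarrow> real"
    using suminf_split_initial_segment[OF that, of "Suc k"] by simp
  have "(\<Sum>i<k. ?a i) = (\<Sum>i<k. ?b i)"
    using agree by (intro sum.cong) (auto simp: indicator_def)
  moreover have "0 \<le> (\<Sum>n. ?a (n + Suc k))"
    using summable_ignore_initial_segment[OF summable_ternary[of A], of "Suc k"]
    by (intro suminf_nonneg) auto
  moreover have "(\<Sum>n. ?b (n + Suc k)) \<le> (\<Sum>n. (1/3) ^ Suc k * (1/3::real) ^ n)"
    by (intro suminf_le summable_mult summable_geometric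
          summable_ignore_initial_segment[OF summable_ternary[of B]])
       (auto simp: indicator_def power_add)
  moreover have "(\<Sum>n. (1/3) ^ Suc k * (1/3::real) ^ n) = (1/3) ^ k / 2"
    by (subst suminf_mult) (auto simp: suminf_geometric)
  moreover have "?a k = (1/3) ^ k" "?b k = 0" using assms by auto
  moreover have "(1/3::real) ^ k > 0" by simp
  ultimately show ?thesis
    unfolding split[OF summable_ternary[of A]] split[OF summable_ternary[of B]] by linarith
qed

lemma inj_ternary: "inj (\<lambda>A. \<Sum>k. (1/3::real) ^ k * indicator A k)"
proof (rule injI, rule ccontr)
  fix A B :: "nat set"
  assume eq: "(\<Sum>k. (1/3::real) ^ k * indicator A k) = (\<Sum>k. (1/3) ^ k * indicator B k)" and "A \<noteq> B"
  define k where "k = (LEAST k. (k \<in> A) \<noteq> (k \<in> B))"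
  have "(k \<in> A) \<noteq> (k \<in> B)"
    unfolding k_def by (rule LeastI_ex) (use \<open>A \<noteq> B\<close> in blast)
  moreover have "j \<in> A \<longleftrightarrow> j \<in> B" if "j < k" for j
    using not_less_Least[OF that[unfolded k_def]] by blast
  ultimately show False
    using ternary_less[of k A B] ternary_less[of k B A] eq by auto
qed

section \<open>An injection of Euclidean space into the line that is continuous off a null
  set\<close>

lemma ex_rat_between:
  fixes x y :: real
  assumes "x \<noteq> y"
  obtains q where "q \<in> \<rat>" "min x y < q" "q < max x y"
proof -
  have "min x y < max x y" using assms by linarith
  then show ?thesis using that Rats_dense_in_real by blast
qed

text \<open>The ternary digits of \<open>s x\<close> record which of the countably many rational
  coordinate half-spaces contain \<open>x\<close>. These separate points, so \<open>s\<close> is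
  injective. Each digit is locally constant off the bounding hyperplane, and the series converges
  uniformly, so \<open>s\<close> is continuous off the countable union \<open>Z\<close> of these
  hyperplanes.\<close>

lemma ex_injective_continuous_off_null:
  obtains s :: "'a::euclidean_space \<Rightarrow> real" and Z
  where "inj s" "s \<in> borel_measurable borel" "Z \<in> null_sets lborel" "continuous_on (- Z) s"
proof -
  define I where "I = (Basis :: 'a set) \<times> (\<rat> :: real set)"
  have I: "countable I" "I \<noteq> {}"
    unfolding I_def by (auto intro!: countable_SIGMA simp: countable_rat countable_finite)
  define e where "e = from_nat_into I"
  define H where "H k = {x. snd (e k) < x \<bullet> fst (e k)}" for k
  define s where "s x = (\<Sum>k. (1/3::real) ^ k * indicator (H k) x)" for x
  define Z where "Z = (\<Union>k. {x. x \<bullet> fst (e k) = snd (e k)})"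
  have e: "e k \<in> I" for k
    using I by (simp add: e_def from_nat_into)
  have ind: "indicator (H k) x = indicator {k. x \<in> H k} k" for k x
    by (simp add: indicator_def)
  have "inj s"
  proof (rule injI, rule ccontr)
    fix x y assume "s x = s y" "x \<noteq> y"
    then have *: "{k. x \<in> H k} = {k. y \<in> H k}"
      using inj_ternary unfolding s_def ind by (auto dest: injD)
    obtain b where b: "b \<in> Basis" "x \<bullet> b \<noteq> y \<bullet> b"
      using \<open>x \<noteq> y\<close> euclidean_eq_iff by blast
    then obtain q where q: "q \<in> \<rat>" "min (x \<bullet> b) (y \<bullet> b) < q" "q < max (x \<bullet> b) (y \<bullet> b)"
      using ex_rat_between by blast
    obtain k where "e k = (b, q)"
      using from_nat_into_surj[of I "(b, q)"] I b q unfolding e_def I_def by blast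
    then have "(x \<in> H k) \<noteq> (y \<in> H k)"
      using q by (auto simp: H_def min_def max_def split: if_splits)
    with * show False by blast
  qed
  moreover have "s \<in> borel_measurable borel"
  proof -
    have [measurable]: "H k \<in> sets borel" for k
      unfolding H_def by measurable
    show ?thesis unfolding s_def by measurable
  qed
  moreover have "Z \<in> null_sets lborel"
  proof -
    have "{x. x \<bullet> fst (e k) = snd (e k)} \<in> null_sets lborel" for k
    proof -
      have "fst (e k) \<in> Basis" using e[of k] by (auto simp: I_def)
      then have "negligible {x. x \<bullet> fst (e k) = snd (e k)}"
        using negligible_standard_hyperplane by blast
      moreover have "{x. x \<bullet> fst (e k) = snd (e k)} \<in> sets borel" by measurable
      ultimately show ?thesis
        by (auto simp: negligible_iff_null_sets null_sets_def)
    qed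
    then show ?thesis unfolding Z_def by (intro null_sets_UN) auto
  qed
  moreover have "continuous_on (- Z) s"
  proof -
    have "uniform_limit (- Z) (\<lambda>n x. \<Sum>k<n. (1/3::real) ^ k * indicator (H k) x) s sequentially"
      unfolding s_def
      by (rule Weierstrass_m_test[OF _ summable_geometric[of "1/3::real"]]) (auto simp: indicator_def)
    moreover have "continuous_on (- Z) (\<lambda>x. \<Sum>k<n. (1/3::real) ^ k * indicator (H k) x)" for n
    proof (intro continuous_intros continuous_at_imp_continuous_on ballI)
      fix k x assume "x \<in> - Z"
      then have "x \<bullet> fst (e k) \<noteq> snd (e k)" by (auto simp: Z_def)
      moreover have "fst (e k) \<noteq> 0" using e[of k] by (auto simp: I_def)
      ultimately have "x \<notin> frontier (H k)"
        unfolding H_def by (subst inner_commute, subst frontier_halfspace_gt) (auto simp: inner_commute)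
      then show "isCont (\<lambda>x. indicator (H k) x :: real) x"
        by (simp add: isCont_indicator)
    qed
    ultimately show ?thesis
      by (intro uniform_limit_theorem[where F = sequentially]) auto
  qed
  ultimately show ?thesis by (rule that)
qed

subsection \<open>Distribution functions of atomless measures\<close>

text \<open>By continuity each bounded part of a level set is compact, so it has a least point
  \<open>a\<close> and a greatest point \<open>b\<close>; the mass of \<open>{a<..b}\<close> is the
  increment of \<open>cdf M\<close>, which is 0.\<close>

lemma null_cdf_level:
  assumes "real_distribution M" and atomless: "\<And>x. measure M {x} = 0"
  shows "{x. cdf M x = w} \<in> null_sets M"
proof -
  interpret real_distribution M by fact
  have cont: "continuous_on UNIV (cdf M)"
    using isCont_cdf atomless by (simp add: continuous_at_imp_continuous_on)
  let ?J = "\<lambda>n::nat. {x. cdf M x = w} \<inter> {- real n..real n}"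
  have "?J n \<in> null_sets M" for n
  proof (cases "?J n = {}")
    case False
    have comp: "compact (?J n)"
      using continuous_closed_vimage[of "{w}" "cdf M"] cont isCont_cdf atomless
      by (intro closed_Int_compact) (auto simp: vimage_def)
    obtain a b where ab: "a \<in> ?J n" "b \<in> ?J n" "\<And>x. x \<in> ?J n \<Longrightarrow> a \<le> x \<and> x \<le> b"
      using compact_attains_inf[OF comp False] compact_attains_sup[OF comp False] by blast
    have "measure M {a<..b} = 0"
      using cdf_diff_eq[of a b] ab by (cases "a < b") auto
    then have "{a} \<union> {a<..b} \<in> null_sets M"
      using atomless[of a] by (intro null_sets.Un) (auto simp: emeasure_eq_measure)
    moreover have "?J n \<subseteq> {a} \<union> {a<..b}" using ab(3) by force
    ultimately show ?thesis
      using comp by (elim null_sets_subset) (auto intro: borel_compact)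
  qed auto
  then have "(\<Union>n. ?J n) \<in> null_sets M" by (intro null_sets_UN) auto
  moreover have "(\<Union>n. ?J n) = {x. cdf M x = w}"
  proof -
    have "\<exists>n::nat. - real n \<le> x \<and> x \<le> real n" for x
      using real_arch_simple[of "\<bar>x\<bar>"] by (metis abs_le_iff minus_le_iff)
    then show ?thesis by auto
  qed
  ultimately show ?thesis by simp
qed

text \<open>If \<open>cdf M ` E\<close> contained an interval, then outside \<open>E\<close> the preimage of that interval would consist
  of points where \<open>cdf M\<close> is constant on a nondegenerate interval, hence be null as well.\<close>

lemma nowhere_dense_cdf_image:
  assumes "real_distribution M" and atomless: "\<And>x. measure M {x} = 0" and E: "compact E" "E \<in> null_sets M"
  shows "nowhere_dense (cdf M ` E)"
proof (rule ccontr)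
  interpret real_distribution M by fact
  have cont: "continuous_on S (cdf M)" for S
    using isCont_cdf atomless by (simp add: continuous_at_imp_continuous_on)
  have "closed (cdf M ` E)"
    using E cont by (intro compact_imp_closed compact_continuous_image) auto
  moreover assume "\<not> nowhere_dense (cdf M ` E)"
  ultimately obtain z where "z \<in> interior (cdf M ` E)"
    unfolding nowhere_dense_def by auto
  then obtain d where d: "d > 0" "cball z d \<subseteq> cdf M ` E"
    by (auto simp: mem_interior_cball)
  then have "z \<in> cdf M ` E" "z + d \<in> cdf M ` E"
    by (auto simp: subset_iff dist_real_def)
  then obtain a b where ab: "cdf M a = z" "cdf M b = z + d" by auto
  have "a < b" using cdf_nondecreasing[of b a] ab d by linarith
  \<comment> \<open>A point \<open>t\<close> outside \<open>E\<close> shares its value with some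
    \<open>e\<close> in \<open>E\<close>; by monotonicity a rational between them has that value
    too. Levels of rationals therefore suffice, which keeps the union countable.\<close>
  have "{a<..b} \<subseteq> E \<union> (\<Union>q\<in>\<rat>. {x. cdf M x = cdf M q})"
  proof
    fix t assume t: "t \<in> {a<..b}"
    then have "cdf M t \<in> cball z d"
      using cdf_nondecreasing[of a t] cdf_nondecreasing[of t b] ab by (auto simp: dist_real_def)
    then obtain e where e: "e \<in> E" "cdf M t = cdf M e" using d by auto
    show "t \<in> E \<union> (\<Union>q\<in>\<rat>. {x. cdf M x = cdf M q})"
    proof (cases "t = e")
      case False
      then obtain q where q: "q \<in> \<rat>" "min t e < q" "q < max t e"
        by (rule ex_rat_between)
      have "cdf M q = cdf M t"
        using q e cdf_nondecreasing[of "min t e" q] cdf_nondecreasing[of q "max t e"]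
        by (auto simp: min_def max_def split: if_splits)
      with q show ?thesis by (metis (mono_tags, lifting) UN_I UnI2 mem_Collect_eq)
    qed (use e in auto)
  qed
  moreover have "E \<union> (\<Union>q\<in>\<rat>. {x. cdf M x = cdf M q}) \<in> null_sets M"
    using E null_cdf_level[OF assms(1) atomless]
    by (intro null_sets.Un null_sets_UN') (auto simp: countable_rat)
  ultimately have "{a<..b} \<in> null_sets M"
    by (elim null_sets_subset) auto
  then have "measure M {a<..b} = 0" by (simp add: measure_eq_0_null_sets)
  then show False using cdf_diff_eq[OF \<open>a < b\<close>] ab d by simp
qed

text \<open>If \<open>cdf M t = w\<close>, let \<open>a\<close> be the largest point of
  \<open>S\<close> up to \<open>t\<close>. The gap \<open>{a<..t}\<close> misses \<open>S\<close>
  and carries no mass, so \<open>cdf M a = w\<close> as well.\<close>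

lemma cdf_image_carrier:
  assumes "real_distribution M" and atomless: "\<And>x. measure M {x} = 0" and S: "compact S" "- S \<in> null_sets M"
  shows "{0<..<1} \<subseteq> cdf M ` S"
proof
  interpret real_distribution M by fact
  fix w :: real assume w: "w \<in> {0<..<1}"
  have cont: "isCont (cdf M) x" for x
    using isCont_cdf atomless by simp
  obtain l where l: "cdf M l < w"
    using order_tendstoD(2)[OF cdf_lim_at_bot, of w] w by (auto simp: eventually_at_bot_linorder)
  obtain u where u: "w < cdf M u"
    using order_tendstoD(1)[OF cdf_lim_at_top_prob, of w] w by (auto simp: eventually_at_top_linorder)
  have "l \<le> u" using cdf_nondecreasing[of u l] l u by linarith
  then obtain t where t: "cdf M t = w"
    using IVT[of "cdf M" l w u] l u cont by auto
  have comp: "compact (S \<inter> {..t})" using S by (intro compact_Int_closed) auto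
  have null: "measure M T = 0" if "T \<subseteq> - S" for T
  proof -
    have "measure M T \<le> measure M (- S)" if "T \<in> sets M"
      using that \<open>T \<subseteq> - S\<close> S by (intro finite_measure_mono) auto
    then show ?thesis
      using measure_eq_0_null_sets[OF S(2)] measure_notin_sets[of T M] measure_nonneg[of M T] by fastforce
  qed
  have "S \<inter> {..t} \<noteq> {}"
    using null[of "{..t}"] t w by (auto simp: cdf_def)
  then obtain a where a: "a \<in> S" "a \<le> t" "\<And>x. x \<in> S \<Longrightarrow> x \<le> t \<Longrightarrow> x \<le> a"
    using compact_attains_sup[OF comp] by auto
  have "cdf M t = cdf M a"
  proof (cases "a < t")
    case True
    moreover have "{a<..t} \<subseteq> - S" using a(3) by force
    ultimately show ?thesis using null cdf_diff_eq[OF True] by simp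
  qed (use a in auto)
  with a t show "w \<in> cdf M ` S" by auto
qed

subsection \<open>Covering nonnull sets by closed null sets\<close>

text \<open>Inner regularity by closed sets, with a finite error \<open>e\<close> below the possibly
  infinite measure of \<open>K\<close>, gives a nonnull closed set; one of its intersections with
  the balls of integer radius must be nonnull.\<close>

lemma ex_compact_nonnull_subset:
  fixes K :: "'a::euclidean_space set"
  assumes K: "K \<in> sets borel" "K \<notin> null_sets lborel"
  obtains T where "compact T" "T \<subseteq> K" "T \<notin> null_sets lborel"
proof -
  have "emeasure lborel K > 0"
    using K by (auto simp: null_sets_def zero_less_iff_neq_zero)
  then obtain d where d: "0 < d" "d < emeasure lborel K" using dense by blast
  then have "d < top" using order_less_le_trans top_greatest by blast
  then obtain e :: real where e: "e > 0" "ennreal e < emeasure lborel K"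
    using d by (cases d) auto
  obtain T where T: "closed T" "T \<subseteq> K" "emeasure lebesgue (K - T) < ennreal e"
    using sets_lebesgue_inner_closed[OF _ e(1), of K] K(1) by (metis lborelD sets_completionI_sets)
  have "T \<notin> null_sets lborel"
  proof
    assume "T \<in> null_sets lborel"
    then have "emeasure lborel (K - T) = emeasure lborel K"
      using K by (intro emeasure_Diff_null_set) auto
    moreover have "emeasure lebesgue (K - T) = emeasure lborel (K - T)"
      using K T by (intro emeasure_completion[THEN trans]) (auto intro: borel_closed)
    ultimately show False using T e by simp
  qed
  moreover have "T = (\<Union>n::nat. T \<inter> cball 0 (real n))"
  proof -
    have "\<exists>n::nat. x \<in> cball 0 (real n)" for x :: 'a
      using real_arch_simple[of "norm x"] by simp
    then show ?thesis by blast
  qed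
  ultimately obtain n :: nat where "T \<inter> cball 0 (real n) \<notin> null_sets lborel"
    by (metis (no_types, lifting) null_sets_UN)
  then show ?thesis
    using T by (intro that[of "T \<inter> cball 0 (real n)"]) (auto intro: closed_Int_compact)
qed

lemma nowhere_dense_translation:
  fixes S :: "'a::real_normed_vector set"
  assumes "nowhere_dense S"
  shows "nowhere_dense ((+) c ` S)"
  using assms by (simp add: nowhere_dense_def closure_translation interior_translation)

text \<open>Otherwise the images of the sets \<open>T \<inter> N i\<close> under \<open>s\<close>
  followed by \<open>cdf M\<close> would be nowhere dense sets covering the open unit interval, and
  their translates would form a meager cover of the line indexed by \<open>I\<close>.\<close>

lemma nonnull_not_covered:
  fixes K :: "'a::euclidean_space set" and N :: "'i \<Rightarrow> 'a set"
  assumes cov: "\<forall>F. meager_cover F \<longrightarrow> |UNIV::real set| \<le>o |F|"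
    and I: "|I| <o |UNIV::real set|"
    and N: "\<And>i. i \<in> I \<Longrightarrow> closed (N i)" "\<And>i. i \<in> I \<Longrightarrow> N i \<in> null_sets lborel"
    and K: "K \<in> sets borel" "K \<notin> null_sets lborel"
  obtains x where "x \<in> K" "\<And>i. i \<in> I \<Longrightarrow> x \<notin> N i"
proof (rule ccontr)
  assume "\<not> thesis"
  with that have covered: "K \<subseteq> (\<Union>i\<in>I. N i)" by blast
  obtain s :: "'a \<Rightarrow> real" and Z where s: "inj s" and [measurable]: "s \<in> borel_measurable borel"
    and Z: "Z \<in> null_sets lborel" and cont: "continuous_on (- Z) s"
    by (rule ex_injective_continuous_off_null)
  have "K - Z \<notin> null_sets lborel"
  proof
    assume "K - Z \<in> null_sets lborel"
    then have "(K - Z) \<union> Z \<in> null_sets lborel" using Z by (rule null_sets.Un)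
    then show False using K null_sets_subset[of "(K - Z) \<union> Z" lborel K] by auto
  qed
  then obtain T where T: "compact T" "T \<subseteq> K - Z" "T \<notin> null_sets lborel"
    using ex_compact_nonnull_subset[of "K - Z"] K(1) null_setsD2[OF Z]
    by (metis sets.Diff sets_lborel)
  have T_borel [measurable]: "T \<in> sets borel" using T by (simp add: borel_compact)
  have T0: "emeasure lborel T \<noteq> 0" using T T_borel by (auto simp: null_sets_def)
  have Tfin: "emeasure lborel T < \<infinity>" by (rule emeasure_compact_finite[OF T(1)])
  have cont_T: "continuous_on T s" using cont T by (auto elim: continuous_on_subset)
  \<comment> \<open>The image under \<open>s\<close> of normalized Lebesgue measure on
    \<open>T\<close>. It has no atoms because \<open>s\<close> is injective.\<close>
  define M where "M = distr (uniform_measure lborel T) borel s"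
  interpret U: prob_space "uniform_measure lborel T"
    using T0 Tfin by (intro prob_space_uniform_measure) auto
  interpret real_distribution M
    unfolding M_def by (rule U.real_distribution_distr) simp
  have nullI: "E \<in> null_sets M" if "E \<in> sets borel" "T \<inter> s -` E \<in> null_sets lborel" for E
  proof -
    have [measurable]: "E \<in> sets borel" by fact
    have "emeasure M E = emeasure (uniform_measure lborel T) (s -` E)"
      unfolding M_def by (subst emeasure_distr) auto
    also have "\<dots> = emeasure lborel (T \<inter> s -` E) / emeasure lborel T"
      using measurable_sets_borel[of s borel E] by (intro emeasure_uniform_measure) auto
    also have "\<dots> = 0" using that by auto
    finally show ?thesis using that by auto
  qed
  have atomless: "measure M {x} = 0" for x
  proof -
    have "T \<inter> s -` {x} \<subseteq> {inv s x}" using s by auto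
    then have "finite (T \<inter> s -` {x})" by (rule finite_subset) simp
    then have "{x} \<in> null_sets M"
      by (intro nullI) (auto intro: finite_imp_null_set_lborel)
    then show ?thesis by (simp add: measure_eq_0_null_sets)
  qed
  define E where "E i = s ` (T \<inter> N i)" for i
  have E_comp: "compact (E i)" if "i \<in> I" for i
    using T N[OF that] cont_T unfolding E_def
    by (intro compact_continuous_image compact_Int_closed) (auto elim: continuous_on_subset)
  have "E i \<in> null_sets M" if "i \<in> I" for i
  proof (rule nullI)
    \<comment> \<open>Injectivity of \<open>s\<close> ensures that pulling \<open>E i\<close> back
      adds no further points of \<open>T\<close>.\<close>
    have "T \<inter> s -` E i = T \<inter> N i"
      unfolding E_def using s by (auto dest: injD)
    moreover have "T \<inter> N i \<in> null_sets lborel"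
      using N(2)[OF that] by (rule null_sets_subset) (use N(2)[OF that] in auto)
    ultimately show "T \<inter> s -` E i \<in> null_sets lborel" by simp
  qed (use E_comp that in \<open>auto intro: borel_compact\<close>)
  then have nd: "nowhere_dense (cdf M ` E i)" if "i \<in> I" for i
    using nowhere_dense_cdf_image[OF real_distribution_axioms atomless E_comp] that by blast
  have "- (s ` T) \<in> null_sets M"
  proof (rule nullI)
    have "T \<inter> s -` (- (s ` T)) = {}" by auto
    then show "T \<inter> s -` (- (s ` T)) \<in> null_sets lborel" by (simp only: null_sets.empty_sets)
    show "- (s ` T) \<in> sets borel"
      using T cont_T by (intro borel_comp borel_compact compact_continuous_image)
  qed
  then have "{0<..<1} \<subseteq> cdf M ` (s ` T)"
    using T cont_T by (intro cdf_image_carrier real_distribution_axioms atomless compact_continuous_image)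
  moreover have "s ` T \<subseteq> (\<Union>i\<in>I. E i)"
  proof
    fix t assume "t \<in> s ` T"
    then obtain u where u: "u \<in> T" "t = s u" by blast
    then obtain i where "i \<in> I" "u \<in> N i" using T(2) covered by blast
    with u show "t \<in> (\<Union>i\<in>I. E i)" unfolding E_def by (intro UN_I[of i]) simp_all
  qed
  ultimately have unit: "{0<..<1} \<subseteq> (\<Union>i\<in>I. cdf M ` E i)"
    unfolding image_UN[symmetric] by (meson image_mono order_trans)
  \<comment> \<open>Steps of 1/2 are used because integer translates of the open unit interval miss
    the integers. All translates for one \<open>i\<close> are merged into one meager set, so that
    \<open>F\<close> is an image of \<open>I\<close>.\<close>
  define F where "F = (\<lambda>i. \<Union>k::int. (+) (of_int k / 2) ` (cdf M ` E i)) ` I"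
  have "meager_cover F"
    unfolding meager_cover_def
  proof (intro conjI ballI)
    fix S assume "S \<in> F"
    then obtain i where i: "i \<in> I" "S = (\<Union>k::int. (+) (of_int k / 2) ` (cdf M ` E i))"
      unfolding F_def by blast
    then show "meager S"
      unfolding meager_def
      by (intro exI[of _ "range (\<lambda>k::int. (+) (of_int k / 2) ` (cdf M ` E i))"])
         (auto intro!: nowhere_dense_translation nd simp del: image_image)
  next
    have "z \<in> \<Union>F" for z
    proof -
      \<comment> \<open>This choice puts \<open>z - of_int k / 2\<close> into the half-open interval
        from 0 (excluded) to 1/2.\<close>
      define k where "k = \<lceil>2 * z\<rceil> - 1"
      have "z - of_int k / 2 \<in> {0<..<1}"
        unfolding k_def by (simp add: field_simps) linarith
      then obtain i where "i \<in> I" "z - of_int k / 2 \<in> cdf M ` E i" using unit by blast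
      moreover from this have "z \<in> (+) (of_int k / 2) ` (cdf M ` E i)"
        by (metis add_diff_cancel_left' diff_add_cancel add.commute image_eqI)
      ultimately show ?thesis unfolding F_def by blast
    qed
    then show "\<Union>F = UNIV" by blast
  qed
  then have "|UNIV::real set| \<le>o |F|" using cov by blast
  also have "|F| \<le>o |I|" unfolding F_def by (rule card_of_image)
  finally show False using I not_ordLess_ordLeq by blast
qed

section \<open>Fibres of closed single-valued relations and enumeration of closed sets\<close>

text \<open>Fibres over distinct values are disjoint compact subsets of \<open>Q\<close>, so their
  measures have sum at most the measure of \<open>Q\<close>, and only countably many are
  nonzero.\<close>

lemma countable_nonnull_fibres:
  fixes G :: "('a::euclidean_space \<times> real) set"
  assumes G: "closed G" "\<And>x y z. (x, y) \<in> G \<Longrightarrow> (x, z) \<in> G \<Longrightarrow> y = z"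
    and Q: "compact Q"
  shows "countable {y. {x \<in> Q. (x, y) \<in> G} \<notin> null_sets lborel}"
proof -
  define X where "X y = {x \<in> Q. (x, y) \<in> G}" for y
  have "compact (X y)" for y
  proof -
    have "X y = Q \<inter> (\<lambda>x. (x, y)) -` G" by (auto simp: X_def)
    moreover have "closed ((\<lambda>x. (x, y)) -` G)"
      using G(1) by (intro closed_vimage continuous_intros)
    ultimately show ?thesis using Q by auto
  qed
  then have meas: "X y \<in> sets lborel" "emeasure lborel (X y) \<noteq> \<infinity>" for y
    using emeasure_compact_finite[of "X y"] by (auto simp: borel_compact)
  have "sum (\<lambda>y. measure lborel (X y)) F \<le> measure lborel Q" if "finite F" for F
  proof -
    have "disjoint_family_on X F"
      using G(2) by (auto simp: disjoint_family_on_def X_def)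
    then have "sum (\<lambda>y. measure lborel (X y)) F = measure lborel (\<Union>y\<in>F. X y)"
      using meas that by (intro measure_finite_Union[symmetric]) auto
    also have "\<dots> \<le> measure lborel Q"
      using Q that meas emeasure_compact_finite[OF Q]
      by (intro measure_mono_fmeasurable) (auto simp: X_def fmeasurable_def borel_compact sets.finite_UN)
    finally show ?thesis .
  qed
  then have "(\<lambda>y. measure lborel (X y)) summable_on UNIV"
    by (intro nonneg_bdd_above_summable_on bdd_aboveI[of _ "measure lborel Q"]) auto
  then have "countable {y. measure lborel (X y) \<noteq> 0}"
    using summable_countable_real by fastforce
  moreover have "{y. X y \<notin> null_sets lborel} \<subseteq> {y. measure lborel (X y) \<noteq> 0}"
    using meas by (auto simp: null_sets_def emeasure_eq_ennreal_measure)
  ultimately show ?thesis unfolding X_def by (rule countable_subset[rotated])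
qed

text \<open>An open set is determined by the set of indices of basic open sets composing it, and the
  ternary series codes sets of indices by reals.\<close>

lemma ex_real_enumeration_closed:
  "\<exists>e :: real \<Rightarrow> 'a::euclidean_space set. \<forall>C. closed C \<longrightarrow> C \<in> range e"
proof (rule univ_second_countable_sequence)
  fix B :: "nat \<Rightarrow> 'a set"
  assume B: "\<And>S. open S \<Longrightarrow> \<exists>k. S = \<Union>{B n |n. n \<in> k}"
  define t where "t A = (\<Sum>k. (1/3::real) ^ k * indicator A k)" for A
  have t: "inv t (t A) = A" for A
    using inv_f_f[OF inj_ternary] by (simp add: t_def[abs_def])
  define e where "e r = - (\<Union>n\<in>inv t r. B n)" for r
  have "C \<in> range e" if C: "closed C" for C
  proof -
    obtain k where "- C = \<Union>{B n |n. n \<in> k}" using B[of "- C"] C by auto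
    then have "C = e (t k)" unfolding e_def t by blast
    then show ?thesis by blast
  qed
  then show ?thesis by blast
qed

subsection \<open>The transfinite construction\<close>

text \<open>Stands in for a uniformly continuous function onto an interval. It does not mention the
  domain \<open>A\<close>, which is unknown until the recursion ends, and such closed sets can be
  indexed by reals.\<close>

definition single_valued_over_interval :: "('a::euclidean_space \<times> real) set \<Rightarrow> bool" where
  "single_valued_over_interval G \<longleftrightarrow> closed G \<and>
     (\<forall>x y z. (x, y) \<in> G \<longrightarrow> (x, z) \<in> G \<longrightarrow> y = z) \<and> (\<exists>a b. a < b \<and> snd ` G = {a..b})"

text \<open>The values to avoid are the countable set \<open>B\<close> with nonnull fibre and the
  set \<open>W\<close> attained on \<open>X\<close>, which is no larger than \<open>X\<close> by
  single-valuedness. Fewer than continuum many singletons cannot cover the interval.\<close>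

lemma ex_null_fibre_avoiding:
  fixes G :: "('a::euclidean_space \<times> real) set"
  assumes cov: "\<forall>F. meager_cover F \<longrightarrow> |UNIV::real set| \<le>o |F|"
    and G: "single_valued_over_interval G" and Q: "compact Q"
    and X: "|X| <o |UNIV::real set|"
  obtains y where "y \<in> snd ` G" "{x \<in> Q. (x, y) \<in> G} \<in> null_sets lborel" "\<forall>x\<in>X. (x, y) \<notin> G"
proof -
  have sv: "\<And>x y z. (x, y) \<in> G \<Longrightarrow> (x, z) \<in> G \<Longrightarrow> y = z" and "closed G"
    using G by (auto simp: single_valued_over_interval_def)
  obtain a b where ab: "a < b" "snd ` G = {a..b}"
    using G by (auto simp: single_valued_over_interval_def)
  define B where "B = {y. {x \<in> Q. (x, y) \<in> G} \<notin> null_sets lborel}"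
  define W where "W = {y. \<exists>x\<in>X. (x, y) \<in> G}"
  have "countable B"
    unfolding B_def using \<open>closed G\<close> sv Q by (rule countable_nonnull_fibres)
  have "\<not> |UNIV::real set| \<le>o |B|"
  proof
    assume "|UNIV::real set| \<le>o |B|"
    then obtain g :: "real \<Rightarrow> real" where "inj g" "range g \<subseteq> B"
      unfolding card_of_ordLeq[symmetric] by blast
    then have "countable (UNIV :: real set)"
      using \<open>countable B\<close> countable_subset countable_image_inj_on by blast
    then show False using uncountable_UNIV_real by blast
  qed
  then have "|B| <o |UNIV::real set|"
    using not_ordLeq_iff_ordLess[OF card_of_Well_order card_of_Well_order] by blast
  moreover have "|W| <o |UNIV::real set|"
  proof -
    have "W \<subseteq> (\<lambda>x. THE y. (x, y) \<in> G) ` X"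
    proof
      fix y assume "y \<in> W"
      then obtain x where x: "x \<in> X" "(x, y) \<in> G" by (auto simp: W_def)
      then have "(THE y. (x, y) \<in> G) = y" using sv by blast
      with x show "y \<in> (\<lambda>x. THE y. (x, y) \<in> G) ` X" by force
    qed
    then have "|W| \<le>o |X|"
      using surj_imp_ordLeq by blast
    then show ?thesis using X by (rule ordLeq_ordLess_trans)
  qed
  ultimately have "|B \<union> W| <o |UNIV::real set|"
    by (intro card_of_Un_ordLess_infinite) (auto simp: infinite_UNIV_char_0)
  then obtain y where "y \<in> {a<..<b}" "\<And>i. i \<in> B \<union> W \<Longrightarrow> y \<notin> {i}"
    by (rule nonnull_not_covered[OF cov, where N = "\<lambda>i. {i}" and K = "{a<..<b}"])
       (use ab in \<open>auto simp: null_sets_def\<close>)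
  then show ?thesis
    using ab(2) by (intro that[of y]) (auto simp: B_def W_def)
qed

lemma ex_point_avoiding_fibres:
  fixes G :: "'i \<Rightarrow> ('a::euclidean_space \<times> real) set"
  assumes cov: "\<forall>F. meager_cover F \<longrightarrow> |UNIV::real set| \<le>o |F|"
    and J: "|J| <o |UNIV::real set|"
    and Q: "compact Q" and K: "compact K" "K \<subseteq> Q" "K \<notin> null_sets lborel"
    and G: "\<forall>j\<in>J. closed (G j) \<and> {x \<in> Q. (x, Y j) \<in> G j} \<in> null_sets lborel"
  obtains x where "x \<in> K" "\<forall>j\<in>J. (x, Y j) \<notin> G j"
proof -
  have closed: "closed {x \<in> Q. (x, Y j) \<in> G j}" if "j \<in> J" for j
  proof -
    have "{x \<in> Q. (x, Y j) \<in> G j} = Q \<inter> (\<lambda>x. (x, Y j)) -` G j" by auto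
    moreover have "closed ((\<lambda>x. (x, Y j)) -` G j)"
      using G that by (intro closed_vimage continuous_intros) auto
    ultimately show ?thesis using compact_imp_closed[OF Q] by auto
  qed
  obtain x where x: "x \<in> K" "\<And>j. j \<in> J \<Longrightarrow> x \<notin> {x \<in> Q. (x, Y j) \<in> G j}"
    using J by (rule nonnull_not_covered[OF cov, where N = "\<lambda>j. {x \<in> Q. (x, Y j) \<in> G j}" and K = K])
      (use closed G K in \<open>auto simp: borel_compact\<close>)
  show ?thesis
  proof (rule that[OF x(1)], intro ballI notI)
    fix j assume "j \<in> J" "(x, Y j) \<in> G j"
    then show False using x K(2) by blast
  qed
qed

text \<open>Stage \<open>i\<close> of a recursion along the cardinal well-order of the reals first promises a value
  \<open>y\<close> of the \<open>i\<close>-th graph, with null fibre, which no point of the set will attain, and then picks a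
  point of the \<open>i\<close>-th nonnull compact set outside the fewer than continuum many null closed
  fibres forbidden so far.\<close>

lemma ex_recursive_choice:
  fixes G :: "real \<Rightarrow> ('a::euclidean_space \<times> real) set" and K :: "real \<Rightarrow> 'a set"
  assumes cov: "\<forall>F. meager_cover F \<longrightarrow> |UNIV::real set| \<le>o |F|"
    and Q: "compact Q"
    and K: "\<And>i. compact (K i)" "\<And>i. K i \<subseteq> Q" "\<And>i. K i \<notin> null_sets lborel"
  obtains x y where "\<forall>i. x i \<in> K i"
    "\<forall>i. single_valued_over_interval (G i) \<longrightarrow> y i \<in> snd ` G i \<and> (\<forall>k. (x k, y i) \<notin> G i)"
proof -
  define R where "R = |UNIV::real set|"
  have R: "Well_order R" "Field R = UNIV" "Card_order R"
    unfolding R_def by (rule card_of_Well_order, rule Field_card_of, rule card_of_Card_order)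
  have underS: "|underS R i| <o |UNIV::real set|" for i
    using card_of_underS[OF R(3), of i] R(2) by (simp add: R_def)
  define good where "good i \<longleftrightarrow> single_valued_over_interval (G i)" for i
  define fibre where "fibre i y = {x \<in> Q. (x, y) \<in> G i}" for i y
  \<comment> \<open>The pair \<open>p\<close> is the point and the promised value of stage
    \<open>i\<close>. The value must not be attained at earlier points or at the new point, and the
    new point must respect all earlier promises.\<close>
  define P where "P f i p \<longleftrightarrow> fst p \<in> K i \<and>
      (good i \<longrightarrow> snd p \<in> snd ` G i \<and> fibre i (snd p) \<in> null_sets lborel \<and>
         (\<forall>j\<in>underS R i. (fst (f j), snd p) \<notin> G i) \<and> p \<notin> G i) \<and>
      (\<forall>j\<in>underS R i. good j \<longrightarrow> (fst p, snd (f j)) \<notin> G j)" for f i p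
  have "\<exists>f. \<forall>i. P f i (f i)"
  proof (rule dependent_wf_choice)
    show "wf (R - Id)" using R(1) by (simp add: well_order_on_def)
  next
    fix f g :: "real \<Rightarrow> 'a \<times> real" and i p
    assume "\<And>j. (j, i) \<in> R - Id \<Longrightarrow> f j = g j"
    then have "\<forall>j\<in>underS R i. f j = g j" by (auto simp: underS_def)
    then show "P f i p = P g i p" unfolding P_def by simp
  next
    fix i and f :: "real \<Rightarrow> 'a \<times> real"
    assume IH: "\<And>j. (j, i) \<in> R - Id \<Longrightarrow> P f j (f j)"
    have small: "|(\<lambda>j. fst (f j)) ` underS R i| <o |UNIV::real set|"
      using card_of_image underS by (rule ordLeq_ordLess_trans)
    obtain y where y: "good i \<Longrightarrow> y \<in> snd ` G i" "good i \<Longrightarrow> fibre i y \<in> null_sets lborel"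
      "good i \<Longrightarrow> \<forall>j\<in>underS R i. (fst (f j), y) \<notin> G i"
    proof (cases "good i")
      case True
      obtain y where "y \<in> snd ` G i" "{x \<in> Q. (x, y) \<in> G i} \<in> null_sets lborel"
        and avoid: "\<forall>x\<in>(\<lambda>j. fst (f j)) ` underS R i. (x, y) \<notin> G i"
        using cov True[unfolded good_def] Q small by (rule ex_null_fibre_avoiding)
      moreover have "\<forall>j\<in>underS R i. (fst (f j), y) \<notin> G i" using avoid by blast
      ultimately show ?thesis by (intro that) (simp_all add: fibre_def)
    next
      case False
      then show ?thesis using that by blast
    qed
    \<comment> \<open>The promise just made joins the earlier ones, so that a single choice of
      \<open>x\<close> respects them all.\<close>
    define Y where "Y j = (if j = i then y else snd (f j))" for j
    have "|{i} \<union> underS R i| <o |UNIV::real set|"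
    proof (rule card_of_Un_ordLess_infinite[OF _ _ underS])
      show "|{i}| <o |UNIV::real set|"
        by (intro finite_ordLess_infinite card_of_Well_order)
           (auto simp: Field_card_of infinite_UNIV_char_0)
    qed (simp add: infinite_UNIV_char_0)
    moreover have "|{j \<in> {i} \<union> underS R i. good j}| \<le>o |{i} \<union> underS R i|"
      by (rule card_of_mono1) blast
    ultimately have J: "|{j \<in> {i} \<union> underS R i. good j}| <o |UNIV::real set|"
      using ordLeq_ordLess_trans by blast
    have "\<forall>j\<in>{j \<in> {i} \<union> underS R i. good j}.
        closed (G j) \<and> {x \<in> Q. (x, Y j) \<in> G j} \<in> null_sets lborel"
    proof
      fix j assume j: "j \<in> {j \<in> {i} \<union> underS R i. good j}"
      then have "fibre j (Y j) \<in> null_sets lborel"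
        using y(2) IH[of j] by (auto simp: Y_def P_def underS_def)
      moreover have "closed (G j)"
        using j by (simp add: good_def single_valued_over_interval_def)
      ultimately show "closed (G j) \<and> {x \<in> Q. (x, Y j) \<in> G j} \<in> null_sets lborel"
        by (simp add: fibre_def)
    qed
    with cov J Q K obtain x where x: "x \<in> K i"
      and avoid: "\<forall>j\<in>{j \<in> {i} \<union> underS R i. good j}. (x, Y j) \<notin> G j"
      by (rule ex_point_avoiding_fibres)
    have "(x, y) \<notin> G i" if "good i"
      using bspec[OF avoid, of i] that by (simp add: Y_def)
    moreover have "(x, snd (f j)) \<notin> G j" if "j \<in> underS R i" "good j" for j
      using bspec[OF avoid, of j] that by (simp add: Y_def underS_def)
    ultimately have "P f i (x, y)"
      using x y unfolding P_def fst_conv snd_conv by blast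
    then show "\<exists>p. P f i p" ..
  qed
  then obtain f where f: "\<And>i. P f i (f i)" by blast
  show ?thesis
  proof (rule that[of "\<lambda>i. fst (f i)" "\<lambda>i. snd (f i)"], safe)
    show "fst (f i) \<in> K i" for i using f[of i] by (simp add: P_def)
  next
    fix i assume i: "single_valued_over_interval (G i)"
    then show "snd (f i) \<in> snd ` G i" using f[of i] by (simp add: P_def good_def)
    fix k assume bad: "(fst (f k), snd (f i)) \<in> G i"
    have "total_on UNIV R"
      using R(1,2) by (simp add: well_order_on_def linear_order_on_def)
    \<comment> \<open>The three positions of \<open>k\<close> relative to \<open>i\<close>
      correspond to the three avoidance clauses of \<open>P\<close>; in the last case it is the
      later point \<open>k\<close> that respects the promise of \<open>i\<close>.\<close>
    then have "k \<in> underS R i \<or> k = i \<or> i \<in> underS R k"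
      unfolding total_on_def underS_def by blast
    then show False
      using f[of i] f[of k] i bad by (elim disjE) (simp_all add: P_def good_def)
  qed
qed

lemma ex_nonnull_set_missing_values:
  fixes Q :: "'a::euclidean_space set"
  assumes cov: "\<forall>F. meager_cover F \<longrightarrow> |UNIV::real set| \<le>o |F|"
    and Q: "compact Q" "Q \<notin> null_sets lborel"
  obtains A where "A \<subseteq> Q"
    "\<forall>K. compact K \<longrightarrow> K \<subseteq> Q \<longrightarrow> K \<notin> null_sets lborel \<longrightarrow> A \<inter> K \<noteq> {}"
    "\<forall>G. single_valued_over_interval G \<longrightarrow> (\<exists>y\<in>snd ` G. \<forall>x\<in>A. (x, y) \<notin> G)"
proof -
  obtain G :: "real \<Rightarrow> ('a \<times> real) set" where G: "\<forall>C. closed C \<longrightarrow> C \<in> range G"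
    using ex_real_enumeration_closed ..
  obtain H :: "real \<Rightarrow> 'a set" where H: "\<forall>C. closed C \<longrightarrow> C \<in> range H"
    using ex_real_enumeration_closed ..
  \<comment> \<open>Indices of inadmissible sets default to \<open>Q\<close>, so every stage has a
    nonnull compact set to choose from.\<close>
  define K where "K i = (if compact (H i) \<and> H i \<subseteq> Q \<and> H i \<notin> null_sets lborel then H i else Q)" for i
  have K: "compact (K i)" "K i \<subseteq> Q" "K i \<notin> null_sets lborel" for i
    using Q by (simp_all add: K_def)
  obtain x y where x: "\<forall>i. x i \<in> K i"
    and y: "\<forall>i. single_valued_over_interval (G i) \<longrightarrow> y i \<in> snd ` G i \<and> (\<forall>k. (x k, y i) \<notin> G i)"
    using cov Q(1) K by (rule ex_recursive_choice)
  show ?thesis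
  proof (rule that[of "range x"])
    show "range x \<subseteq> Q" using x K(2) by blast
    show "\<forall>K. compact K \<longrightarrow> K \<subseteq> Q \<longrightarrow> K \<notin> null_sets lborel \<longrightarrow> range x \<inter> K \<noteq> {}"
    proof (intro allI impI)
      fix C assume C: "compact C" "C \<subseteq> Q" "C \<notin> null_sets lborel"
      then obtain i where "C = H i" using H compact_imp_closed by blast
      then have "C = K i" using C by (simp add: K_def)
      then have "x i \<in> C" using x by simp
      then show "range x \<inter> C \<noteq> {}" by blast
    qed
    show "\<forall>G. single_valued_over_interval G \<longrightarrow> (\<exists>y\<in>snd ` G. \<forall>x\<in>range x. (x, y) \<notin> G)"
    proof (intro allI impI)
      fix C :: "('a \<times> real) set" assume C: "single_valued_over_interval C"
      then have "C \<in> range G" using G by (simp add: single_valued_over_interval_def)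
      then obtain i where i: "C = G i" by blast
      then have "y i \<in> snd ` C" "\<forall>k. (x k, y i) \<notin> C" using y C by simp_all
      then show "\<exists>y\<in>snd ` C. \<forall>x\<in>range x. (x, y) \<notin> C" by blast
    qed
  qed
qed

text \<open>Two limit values over one \<open>x\<close> would come from graph points with nearby
  arguments and distant values, against uniform continuity. No new values arise, because the range
  is already closed.\<close>

lemma single_valued_closure_graph:
  fixes f :: "'a::euclidean_space \<Rightarrow> real"
  assumes f: "uniformly_continuous_on A f" "f ` A = {a..b}" and "a < b"
  shows "single_valued_over_interval (closure ((\<lambda>x. (x, f x)) ` A))"
      (is "single_valued_over_interval (closure ?g)")
    and "snd ` closure ((\<lambda>x. (x, f x)) ` A) = f ` A"
proof -
  have "snd ` closure ?g \<subseteq> closure (snd ` ?g)"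
    by (intro continuous_image_closure_subset[of UNIV]) (auto intro: continuous_intros)
  moreover have "snd ` ?g = {a..b}" using f(2) by (simp add: image_image)
  moreover have "snd ` ?g \<subseteq> snd ` closure ?g" by (intro image_mono closure_subset)
  ultimately have "snd ` closure ?g = {a..b}" by simp
  then show "snd ` closure ?g = f ` A" using f by simp
  have "y = z" if xy: "(x, y) \<in> closure ?g" and xz: "(x, z) \<in> closure ?g" for x y z
  proof (rule ccontr)
    assume "y \<noteq> z"
    define e where "e = dist y z / 3"
    have "e > 0" using \<open>y \<noteq> z\<close> by (simp add: e_def)
    then obtain d where d: "d > 0" "\<And>u v. u \<in> A \<Longrightarrow> v \<in> A \<Longrightarrow> dist u v < d \<Longrightarrow> dist (f u) (f v) < e"
      using f(1) unfolding uniformly_continuous_on_def by metis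
    \<comment> \<open>The bound \<open>d/2\<close> gives \<open>dist u v < d\<close>; the bound
      \<open>e\<close>, a third of \<open>dist y z\<close>, makes the three legs from
      \<open>y\<close> to \<open>z\<close> too short.\<close>
    have m: "min e (d/2) > 0" using \<open>e > 0\<close> d by simp
    obtain u where u: "u \<in> A" "dist (u, f u) (x, y) < min e (d/2)"
      using closure_approachable[THEN iffD1, OF xy, rule_format, OF m] by auto
    obtain v where v: "v \<in> A" "dist (v, f v) (x, z) < min e (d/2)"
      using closure_approachable[THEN iffD1, OF xz, rule_format, OF m] by auto
    have "dist u x < d/2" "dist (f u) y < e" "dist v x < d/2" "dist (f v) z < e"
      using u(2) v(2) dist_fst_le[of "(u, f u)" "(x, y)"] dist_snd_le[of "(u, f u)" "(x, y)"]
        dist_fst_le[of "(v, f v)" "(x, z)"] dist_snd_le[of "(v, f v)" "(x, z)"] by auto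
    moreover from this have "dist u v < d" using dist_triangle2[of u v x] by linarith
    then have "dist (f u) (f v) < e" using d u v by blast
    moreover have "dist y z \<le> dist (f u) y + dist (f u) (f v) + dist (f v) z"
      using dist_triangle[of y z "f u"] dist_triangle[of "f u" z "f v"] by (simp add: dist_commute)
    ultimately show False unfolding e_def by linarith
  qed
  then show "single_valued_over_interval (closure ?g)"
    unfolding single_valued_over_interval_def
    using \<open>snd ` closure ?g = {a..b}\<close> \<open>a < b\<close> by blast
qed

subsection \<open>Hausdorff dimension of nonnull subsets of the cube\<close>

lemma hausdorff_measure_zero_cover:
  assumes "hausdorff_measure s A = 0" and "\<delta> > 0" "\<epsilon> > 0"
  obtains U :: "nat \<Rightarrow> 'a::metric_space set"
  where "A \<subseteq> (\<Union>i. U i)" "\<forall>i. bounded (U i) \<and> diameter (U i) \<le> \<delta>"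
    "(\<Sum>i. ennreal (diam_pow s (U i))) < \<epsilon>"
proof -
  have "hausdorff_pre s \<delta> A \<le> hausdorff_measure s A"
    unfolding hausdorff_measure_def using \<open>\<delta> > 0\<close> by (intro SUP_upper) auto
  then have "hausdorff_pre s \<delta> A < \<epsilon>" using assms by simp
  then show ?thesis
    unfolding hausdorff_pre_def INF_less_iff using that by blast
qed

text \<open>Each nonempty \<open>U i\<close> lies in a ball about one of its points with radius its
  diameter. As the diameter is at most 1 and \<open>s\<close> at most the dimension, the volume of
  the ball is at most the unit ball volume times \<open>diam_pow s (U i)\<close>.\<close>

lemma emeasure_cover_le_hausdorff_sum:
  fixes U :: "nat \<Rightarrow> 'a::euclidean_space set"
  assumes U: "\<forall>i. bounded (U i) \<and> diameter (U i) \<le> 1"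
    and s: "0 \<le> s" "s \<le> real DIM('a)"
  obtains V where "V \<in> sets borel" "(\<Union>i. U i) \<subseteq> V"
    "emeasure lborel V \<le> ennreal (unit_ball_vol (real DIM('a))) * (\<Sum>i. ennreal (diam_pow s (U i)))"
proof -
  have bd: "bounded (U i)" and diam: "diameter (U i) \<le> 1" for i
    using U by simp_all
  define c where "c = unit_ball_vol (real DIM('a))"
  have c: "c \<ge> 0" unfolding c_def by (rule unit_ball_vol_nonneg) simp
  define B where "B i = (if U i = {} then {} else cball (SOME x. x \<in> U i) (diameter (U i)))" for i
  have "U i \<subseteq> B i" for i
  proof
    fix x assume x: "x \<in> U i"
    then have "(SOME x. x \<in> U i) \<in> U i" by (rule someI)
    then show "x \<in> B i"
      using x diameter_bounded_bound[OF bd[of i]] by (auto simp: B_def)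
  qed
  then have "(\<Union>i. U i) \<subseteq> (\<Union>i. B i)" by blast
  moreover have "emeasure lborel (B i) \<le> ennreal c * ennreal (diam_pow s (U i))" for i
  proof (cases "U i = {}")
    case False
    have d: "0 \<le> diameter (U i)" by (rule diameter_ge_0[OF bd])
    have "diameter (U i) ^ DIM('a) \<le> diam_pow s (U i)"
    proof (cases "s = 0 \<or> diameter (U i) = 0")
      case True
      then show ?thesis
        using False d diam[of i] by (auto simp: diam_pow_def power_le_one power_0_left)
    next
      case nz: False
      then have "diameter (U i) ^ DIM('a) = diameter (U i) powr real DIM('a)"
        using d by (simp add: powr_realpow)
      also have "\<dots> \<le> diameter (U i) powr s"
        using d nz diam[of i] s by (intro powr_mono') auto
      finally show ?thesis using nz False by (simp add: diam_pow_def)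
    qed
    then have "c * diameter (U i) ^ DIM('a) \<le> c * diam_pow s (U i)"
      using c by (rule mult_left_mono)
    moreover have "emeasure lborel (B i) = ennreal (c * diameter (U i) ^ DIM('a))"
      using False d by (simp add: B_def emeasure_cball c_def)
    ultimately show ?thesis
      using c by (simp add: ennreal_mult'[symmetric] ennreal_leI)
  qed (simp add: B_def)
  then have "(\<Sum>i. emeasure lborel (B i)) \<le> (\<Sum>i. ennreal c * ennreal (diam_pow s (U i)))"
    by (intro suminf_le) auto
  then have "emeasure lborel (\<Union>i. B i) \<le> ennreal c * (\<Sum>i. ennreal (diam_pow s (U i)))"
    by (intro order_trans[OF emeasure_subadditive_countably]) (auto simp: B_def)
  ultimately show ?thesis
    unfolding c_def by (intro that[of "\<Union>i. B i"]) (auto simp: B_def)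
qed

text \<open>Positive outer measure is expressed through Borel supersets, as \<open>A\<close> may be
  nonmeasurable. Zero \<open>s\<close>-dimensional measure for \<open>s\<close> below the dimension
  would allow a cover of diameter sum below \<open>m / c\<close>, hence a Borel superset of volume
  below \<open>m\<close>.\<close>

lemma hausdorff_dim_ge_DIM:
  fixes A :: "'a::euclidean_space set"
  assumes "\<And>V. V \<in> sets borel \<Longrightarrow> A \<subseteq> V \<Longrightarrow> emeasure lborel V \<ge> ennreal m" and "m > 0"
  shows "hausdorff_dim A \<ge> ereal (real DIM('a))"
  unfolding hausdorff_dim_def
proof (rule INF_greatest, rule ccontr)
  fix s assume "s \<in> {s. 0 \<le> s \<and> hausdorff_measure s A = 0}" and "\<not> ereal (real DIM('a)) \<le> ereal s"
  then have s: "0 \<le> s" "s \<le> real DIM('a)" and null: "hausdorff_measure s A = 0" by simp_all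
  define c where "c = unit_ball_vol (real DIM('a))"
  have c: "c > 0" unfolding c_def by (rule unit_ball_vol_pos) simp
  have "ennreal (m / c) > 0" using \<open>m > 0\<close> c by simp
  with null zero_less_one obtain U :: "nat \<Rightarrow> 'a set" where U: "A \<subseteq> (\<Union>i. U i)"
    "\<forall>i. bounded (U i) \<and> diameter (U i) \<le> 1" "(\<Sum>i. ennreal (diam_pow s (U i))) < ennreal (m / c)"
    by (rule hausdorff_measure_zero_cover)
  obtain V where V: "V \<in> sets borel" "(\<Union>i. U i) \<subseteq> V"
    "emeasure lborel V \<le> ennreal c * (\<Sum>i. ennreal (diam_pow s (U i)))"
    using U(2) s unfolding c_def by (rule emeasure_cover_le_hausdorff_sum)
  have "ennreal m \<le> emeasure lborel V" using assms(1)[OF V(1) order_trans[OF U(1) V(2)]] .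
  also note V(3)
  also have "ennreal c * (\<Sum>i. ennreal (diam_pow s (U i))) < ennreal c * ennreal (m / c)"
    using U(3) c by (intro ennreal_mult_strict_left_mono) auto
  also have "\<dots> = ennreal m" using c \<open>m > 0\<close> by (simp add: ennreal_mult'[symmetric])
  finally show False by simp
qed

section \<open>The upper bound for the dimension, from grid covers of the cube\<close>

lemma unit_cube_hausdorff_cover:
  assumes "m > 0" "s > 0"
  obtains U :: "nat \<Rightarrow> 'a::euclidean_space set"
  where "cbox 0 One \<subseteq> (\<Union>i. U i)" "\<And>i. bounded (U i)" "\<And>i. diameter (U i) \<le> real DIM('a) / real m"
    "(\<Sum>i. ennreal (diam_pow s (U i))) \<le> ennreal (real m ^ DIM('a) * (real DIM('a) / real m) powr s)"
proof -
  let ?n = "DIM('a)"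
  define I where "I = (\<Pi>\<^sub>E b\<in>(Basis::'a set). {..<m})"
  have I: "finite I" "card I = m ^ ?n"
    unfolding I_def by (auto simp: card_PiE intro!: finite_PiE)
  define C where "C g = cbox (\<Sum>b\<in>Basis. (real (g b) / real m) *\<^sub>R b) (\<Sum>b\<in>Basis. ((real (g b) + 1) / real m) *\<^sub>R b :: 'a)"
    for g :: "'a \<Rightarrow> nat"
  have C: "x \<in> C g \<longleftrightarrow> (\<forall>b\<in>Basis. real (g b) / real m \<le> x \<bullet> b \<and> x \<bullet> b \<le> (real (g b) + 1) / real m)" for x g
    by (simp add: C_def mem_box)
  have C_diam: "diameter (C g) \<le> real ?n / real m" for g
  proof (rule diameter_le)
    fix x y assume xy: "x \<in> C g" "y \<in> C g"
    have "norm (x - y) \<le> (\<Sum>b\<in>Basis. \<bar>(x - y) \<bullet> b\<bar>)" by (rule norm_le_l1)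
    also have "\<dots> \<le> (\<Sum>b\<in>(Basis::'a set). 1 / real m)"
    proof (rule sum_mono)
      fix b :: 'a assume "b \<in> Basis"
      then have "real (g b) / real m \<le> x \<bullet> b" "x \<bullet> b \<le> real (g b) / real m + 1 / real m"
        "real (g b) / real m \<le> y \<bullet> b" "y \<bullet> b \<le> real (g b) / real m + 1 / real m"
        using xy by (auto simp: C add_divide_distrib)
      then show "\<bar>(x - y) \<bullet> b\<bar> \<le> 1 / real m" by (simp add: inner_diff_left)
    qed
    finally show "norm (x - y) \<le> real ?n / real m" by simp
  qed simp
  have cover: "\<exists>g\<in>I. x \<in> C g" if "x \<in> cbox 0 One" for x
  proof -
    \<comment> \<open>The cap \<open>m - 1\<close> puts points with a coordinate equal to 1 into the
      last cell.\<close>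
    define g where "g b = (if b \<in> Basis then min (m - 1) (nat \<lfloor>real m * (x \<bullet> b)\<rfloor>) else undefined)" for b
    have "g \<in> I" using \<open>m > 0\<close> by (auto simp: I_def g_def)
    moreover have "x \<in> C g"
      unfolding C
    proof (intro ballI)
      fix b :: 'a assume b: "b \<in> Basis"
      have x01: "0 \<le> x \<bullet> b" "x \<bullet> b \<le> 1" using that b by (auto simp: mem_box)
      then have mx: "0 \<le> real m * (x \<bullet> b)" "real m * (x \<bullet> b) \<le> real m"
        by (auto simp: mult_left_le)
      define k where "k = nat \<lfloor>real m * (x \<bullet> b)\<rfloor>"
      have k: "real k \<le> real m * (x \<bullet> b)" "real m * (x \<bullet> b) < real k + 1"
        unfolding k_def using mx by linarith+
      have g: "g b = min (m - 1) k" using b by (simp add: g_def k_def)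
      have "real (g b) \<le> real m * (x \<bullet> b)" using k g by linarith
      moreover have "real m * (x \<bullet> b) \<le> real (g b) + 1"
        using k mx g \<open>m > 0\<close> by (auto simp: min_def of_nat_diff)
      ultimately show "real (g b) / real m \<le> x \<bullet> b \<and> x \<bullet> b \<le> (real (g b) + 1) / real m"
        using \<open>m > 0\<close> by (simp add: field_simps)
    qed
    ultimately show ?thesis by blast
  qed
  obtain h where h: "bij_betw h {..<m ^ ?n} I"
    using ex_bij_betw_nat_finite[OF I(1)] I(2) by (auto simp: lessThan_atLeast0)
  \<comment> \<open>Empty sets, of weight 0 in \<open>diam_pow\<close>, pad the finite grid to a
    sequence.\<close>
  define U where "U i = (if i < m ^ ?n then C (h i) else {})" for i
  show ?thesis
  proof (rule that[of U])
    show "cbox 0 One \<subseteq> (\<Union>i. U i)"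
    proof
      fix x :: 'a assume "x \<in> cbox 0 One"
      then obtain g where "g \<in> I" "x \<in> C g" using cover by blast
      moreover from this obtain i where "i < m ^ ?n" "g = h i" using h by (auto simp: bij_betw_def)
      ultimately show "x \<in> (\<Union>i. U i)" by (auto simp: U_def)
    qed
    show "bounded (U i)" for i by (simp add: U_def C_def)
    show "diameter (U i) \<le> real ?n / real m" for i using C_diam by (simp add: U_def)
    have "(\<Sum>i. ennreal (diam_pow s (U i))) = (\<Sum>i<m ^ ?n. ennreal (diam_pow s (U i)))"
      by (intro suminf_finite) (auto simp: U_def diam_pow_def)
    also have "\<dots> \<le> (\<Sum>i<m ^ ?n. ennreal ((real ?n / real m) powr s))"
    proof (intro sum_mono ennreal_leI)
      fix i show "diam_pow s (U i) \<le> (real ?n / real m) powr s"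
        using \<open>s > 0\<close> C_diam[of "h i"] diameter_ge_0[of "C (h i)"]
        by (auto simp: diam_pow_def U_def C_def intro!: powr_mono2)
    qed
    also have "\<dots> = ennreal (real m ^ ?n * (real ?n / real m) powr s)"
      by (simp add: ennreal_mult' ennreal_of_nat_eq_real_of_nat)
    finally show "(\<Sum>i. ennreal (diam_pow s (U i))) \<le> ennreal (real m ^ ?n * (real ?n / real m) powr s)" .
  qed
qed

text \<open>With \<open>n\<close> the dimension, the grid of mesh \<open>1/m\<close> has total
  weight \<open>n powr s * m powr (n - s)\<close>, which tends to 0 because
  \<open>s > n\<close>.\<close>

lemma hausdorff_measure_unit_cube:
  fixes A :: "'a::euclidean_space set"
  assumes A: "A \<subseteq> cbox 0 One" and s: "s > real DIM('a)"
  shows "hausdorff_measure s A = 0"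
proof -
  let ?n = "DIM('a)"
  have "hausdorff_pre s \<delta> A = 0" if "\<delta> > 0" for \<delta>
  proof -
    have lim: "(\<lambda>m. ennreal (real m ^ ?n * (real ?n / real m) powr s)) \<longlonglongrightarrow> ennreal 0"
    proof (rule tendsto_ennrealI)
      have "(\<lambda>m. real ?n powr s * real m powr (real ?n - s)) \<longlonglongrightarrow> real ?n powr s * 0"
        using s by (intro tendsto_intros tendsto_neg_powr filterlim_real_sequentially) auto
      moreover have "\<forall>\<^sub>F m in sequentially. real ?n powr s * real m powr (real ?n - s)
          = real m ^ ?n * (real ?n / real m) powr s"
        using eventually_gt_at_top[of 0]
        by eventually_elim (simp add: powr_divide powr_diff powr_realpow)
      ultimately show "(\<lambda>m. real m ^ ?n * (real ?n / real m) powr s) \<longlonglongrightarrow> 0"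
        using Lim_transform_eventually by fastforce
    qed
    have "\<forall>\<^sub>F m in sequentially. real ?n / \<delta> \<le> real m"
      using filterlim_real_sequentially by (simp add: filterlim_at_top)
    then have "\<forall>\<^sub>F m in sequentially. hausdorff_pre s \<delta> A \<le> ennreal (real m ^ ?n * (real ?n / real m) powr s)"
      using eventually_gt_at_top[of 0]
    proof eventually_elim
      case (elim m)
      then have small: "real ?n / real m \<le> \<delta>"
        using that by (simp add: field_simps)
      obtain U :: "nat \<Rightarrow> 'a set" where U: "cbox 0 One \<subseteq> (\<Union>i. U i)" "\<And>i. bounded (U i)"
        "\<And>i. diameter (U i) \<le> real ?n / real m"
        "(\<Sum>i. ennreal (diam_pow s (U i))) \<le> ennreal (real m ^ ?n * (real ?n / real m) powr s)"
        by (rule unit_cube_hausdorff_cover[of m s]) (use elim s in auto)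
      have "hausdorff_pre s \<delta> A \<le> (\<Sum>i. ennreal (diam_pow s (U i)))"
        unfolding hausdorff_pre_def using U A small by (intro INF_lower) (auto intro: order_trans)
      with U(4) show ?case by order
    qed
    then have "hausdorff_pre s \<delta> A \<le> ennreal 0"
      using lim by (intro tendsto_lowerbound[OF lim]) auto
    then show ?thesis by simp
  qed
  then show ?thesis unfolding hausdorff_measure_def by (simp add: SUP_eq_const)
qed

lemma hausdorff_dim_unit_cube_le:
  fixes A :: "'a::euclidean_space set"
  assumes A: "A \<subseteq> cbox 0 One"
  shows "hausdorff_dim A \<le> ereal (real DIM('a))"
proof (rule ereal_le_epsilon2)
  fix e :: real assume "e > 0"
  then have "hausdorff_measure (real DIM('a) + e) A = 0"
    using A by (intro hausdorff_measure_unit_cube) auto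
  then have "hausdorff_dim A \<le> ereal (real DIM('a) + e)"
    unfolding hausdorff_dim_def using \<open>e > 0\<close> by (intro INF_lower) auto
  then show "hausdorff_dim A \<le> ereal (real DIM('a)) + ereal e" by simp
qed

lemma hausdorff_dim_meeting_nonnull_compacts:
  fixes A :: "'a::euclidean_space set"
  assumes A: "A \<subseteq> cbox 0 One"
    and meets: "\<forall>K. compact K \<longrightarrow> K \<subseteq> cbox 0 One \<longrightarrow> K \<notin> null_sets lborel \<longrightarrow> A \<inter> K \<noteq> {}"
  shows "hausdorff_dim A = ereal (real DIM('a))"
proof (rule antisym)
  show "hausdorff_dim A \<ge> ereal (real DIM('a))"
  proof (rule hausdorff_dim_ge_DIM[where m = 1])
    fix V assume V: "V \<in> sets borel" "A \<subseteq> V"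
    have one: "emeasure lborel (cbox 0 (One::'a)) = 1"
      by (simp add: emeasure_lborel_cbox_eq)
    \<comment> \<open>A nonnull remainder would contain a nonnull compact set, which would meet
      \<open>A\<close> outside \<open>V\<close>.\<close>
    have "cbox 0 One - V \<in> null_sets lborel"
    proof (rule ccontr)
      assume nonnull: "cbox 0 One - V \<notin> null_sets lborel"
      have "cbox 0 One - V \<in> sets borel" using V(1) by auto
      then obtain K where "compact K" "K \<subseteq> cbox 0 One - V" "K \<notin> null_sets lborel"
        using nonnull by (rule ex_compact_nonnull_subset)
      then show False using meets V(2) by blast
    qed
    then have "emeasure lborel (V \<union> (cbox 0 One - V)) = emeasure lborel V"
      using V by (intro emeasure_Un_null_set) auto
    moreover have "emeasure lborel (cbox 0 (One::'a)) \<le> emeasure lborel (V \<union> (cbox 0 One - V))"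
      using V by (intro emeasure_mono) auto
    ultimately show "ennreal 1 \<le> emeasure lborel V" using one by simp
  qed simp
qed (rule hausdorff_dim_unit_cube_le[OF A])

theorem theorem3p2:
  assumes "covM_eq_continuum"
  shows "\<exists>A :: (real ^ 'n) set.
           hausdorff_dim A = ereal (real CARD('n)) \<and>
           \<not> (\<exists>(f :: real ^ 'n \<Rightarrow> real) a b. a < b \<and> uniformly_continuous_on A f \<and> f ` A = {a..b})"
proof -
  have cov: "\<forall>F. meager_cover F \<longrightarrow> |UNIV::real set| \<le>o |F|"
    using assms by (simp add: covM_eq_continuum_def)
  have "cbox 0 (One :: real ^ 'n) \<notin> null_sets lborel"
    by (auto simp: null_sets_def emeasure_lborel_cbox_eq)
  then obtain A :: "(real ^ 'n) set" where A: "A \<subseteq> cbox 0 One"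
    and meets: "\<forall>K. compact K \<longrightarrow> K \<subseteq> cbox 0 One \<longrightarrow> K \<notin> null_sets lborel \<longrightarrow> A \<inter> K \<noteq> {}"
    and misses: "\<forall>G. single_valued_over_interval G \<longrightarrow> (\<exists>y\<in>snd ` G. \<forall>x\<in>A. (x, y) \<notin> G)"
    by (rule ex_nonnull_set_missing_values[OF cov compact_cbox])
  have "\<not> (\<exists>(f :: real ^ 'n \<Rightarrow> real) a b. a < b \<and> uniformly_continuous_on A f \<and> f ` A = {a..b})"
  proof (intro notI, elim exE conjE)
    fix f :: "real ^ 'n \<Rightarrow> real" and a b
    assume f: "uniformly_continuous_on A f" "f ` A = {a..b}" "a < b"
    define G where "G = closure ((\<lambda>x. (x, f x)) ` A)"
    have "single_valued_over_interval G" "snd ` G = f ` A"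
      unfolding G_def by (rule single_valued_closure_graph[OF f])+
    \<comment> \<open>The missed value lies in the range of \<open>f\<close>, since passing to the
      closure of the graph adds no values; yet a point of \<open>A\<close> attaining it gives a pair
      in \<open>G\<close>.\<close>
    with misses obtain y where "y \<in> f ` A" and y: "\<forall>x\<in>A. (x, y) \<notin> G"
      by metis
    then obtain x where "x \<in> A" "y = f x" by blast
    then have "(x, y) \<in> G" unfolding G_def using closure_subset by fastforce
    with y \<open>x \<in> A\<close> show False by blast
  qed
  moreover have "hausdorff_dim A = ereal (real CARD('n))"
    using hausdorff_dim_meeting_nonnull_compacts[OF A meets] by simp
  ultimately show ?thesis by blast
qed

end
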